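(* Let $q\ge1$ and $N>1$ be integers. Let $A$ and $B$ be complex unitary $N\times N$ matrices all of whose first-row entries equal $1/\sqrt N$, with associated generalized Walsh functions $(W_{n,A})_{n\ge0}$ and $(W_{n,B})_{n\ge0}$ and generalized Walsh transforms $\mathcal W_A$ and $\mathcal W_B$. Suppose that $$\langle W_{l,B},W_{k,A}\rangle=\langle W_{l,A},W_{k,B}\rangle\qquad\text{for all } k,l\in\{0,1,\dots,N^q-1\}.$$ Then for every function $f:[0,1]\to\mathbb C$ that is constant on each interval $[i/N^q,(i+1)/N^q)$, $i\in\{0,1,\dots,N^q-1\}$, $$\mathcal W_B^{-1}\circ\mathcal W_A\circ\mathcal W_B^{-1}\circ\mathcal W_A(f)=f$$ as elements of $L^2[0,1]$.
   Context: The inner product is $\langle f,g\rangle=\int_0^1 f(t)\overline{g(t)}\,dt$ on $L^2[0,1]$. Generalized Walsh functions. Let $C=[c_{ij}]_{0\le i,j\le N-1}$ be a complex unitary $N\times N$ matrix with $c_{0j}=1/\sqrt N$ for all $j$. For $0\le i\le N-1$ let $m_i(x)=\sqrt N\sum_{j=0}^{N-1}c_{ij}\chi_{[j/N,(j+1)/N)}(x)$ for $x\in[0,1)$, so $m_0\equiv 1$. Let $r(x)=(Nx)\bmod 1$, i.e. $r(x)=Nx-l$ for $x\in[l/N,(l+1)/N)$, $l\in\{0,\dots,N-1\}$. At the endpoint $x=1$ the convention is $r(1)=1$ and $m_i(1)=\sqrt N c_{i,N-1}$. For an integer $n\ge 0$ with base-$N$ expansion $n=\sum_{k=0}^{p-1}i_kN^k$,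 $i_k\in\{0,\dots,N-1\}$, set $$W_{n,C}(x)=m_{i_0}(x)\,m_{i_1}(r x)\cdots m_{i_{p-1}}(r^{p-1}x),$$ where $r^k$ is the $k$-fold iterate of $r$; $W_{0,C}\equiv1$. The family $(W_{n,C})_{n\ge0}$ is an orthonormal basis of $L^2[0,1]$ (known). The generalized Walsh transform is $\mathcal W_C:L^2[0,1]\to \ell^2(\mathbb N)$, $\mathcal W_C(f)=(\langle f,W_{n,C}\rangle)_{n\ge0}$ (sequences indexed by $n\ge 0$), with inverse $\mathcal W_C^{-1}((a_n)_{n\ge 0})=\sum_{n\ge0}a_nW_{n,C}$ (convergence in $L^2[0,1]$; a finite sum for finitely supported sequences). *)

theory Defs
  imports
    "HOL-Analysis.Analysis"
    "HOL-Library.Log_Nat"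
    "Jordan_Normal_Form.Schur_Decomposition"
begin

text \<open>
  Elements of \<open>L\<^sup>2[0,1]\<close> are represented by functions \<open>real \<Rightarrow> complex\<close>; only their values
  on \<open>[0,1]\<close> matter, and equality in \<open>L\<^sup>2[0,1]\<close> is equality almost everywhere with
  respect to \<open>unit_lebesgue\<close>.
\<close>

abbreviation unit_lebesgue :: "real measure"
  where "unit_lebesgue \<equiv> lebesgue_on {0..1}"

definition L2_unit :: "(real \<Rightarrow> complex) set"
  where "L2_unit = {f \<in> borel_measurable unit_lebesgue.
                      integrable unit_lebesgue (\<lambda>t. (cmod (f t))\<^sup>2)}"

definition L2_inner :: "(real \<Rightarrow> complex) \<Rightarrow> (real \<Rightarrow> complex) \<Rightarrow> complex"
  where "L2_inner f g = integral\<^sup>L unit_lebesgue (\<lambda>t. f t * cnj (g t))"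

definition L2_norm :: "(real \<Rightarrow> complex) \<Rightarrow> real"
  where "L2_norm f = sqrt (integral\<^sup>L unit_lebesgue (\<lambda>t. (cmod (f t))\<^sup>2))"

definition unitary_mat :: "nat \<Rightarrow> complex mat \<Rightarrow> bool"
  where "unitary_mat N C \<longleftrightarrow>
    C \<in> carrier_mat N N \<and> mat_adjoint C * C = 1\<^sub>m N \<and> C * mat_adjoint C = 1\<^sub>m N"

definition walsh_filter :: "nat \<Rightarrow> complex mat \<Rightarrow> nat \<Rightarrow> real \<Rightarrow> complex"
  where "walsh_filter N C i x =
    (if x = 1 then complex_of_real (sqrt (real N)) * C $$ (i, N - 1)
     else complex_of_real (sqrt (real N)) *
       (\<Sum>j<N. C $$ (i, j) * indicator {real j / real N ..< (real j + 1) / real N} x))"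

definition walsh_shift :: "nat \<Rightarrow> real \<Rightarrow> real"
  where "walsh_shift N x = (if x = 1 then 1 else frac (real N * x))"

text \<open>
  For \<open>N > 1\<close>, \<open>floorlog N n\<close> is the number of base-\<open>N\<close> digits of \<open>n\<close> (and \<open>0\<close> for \<open>n = 0\<close>),
  and \<open>(n div N ^ k) mod N\<close> is the digit with weight \<open>N ^ k\<close>.
\<close>

definition walsh :: "nat \<Rightarrow> complex mat \<Rightarrow> nat \<Rightarrow> real \<Rightarrow> complex"
  where "walsh N C n x =
    (\<Prod>k<floorlog N n. walsh_filter N C ((n div N ^ k) mod N) ((walsh_shift N ^^ k) x))"

definition walsh_transform :: "nat \<Rightarrow> complex mat \<Rightarrow> (real \<Rightarrow> complex) \<Rightarrow> nat \<Rightarrow> complex"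
  where "walsh_transform N C f = (\<lambda>n. L2_inner f (walsh N C n))"

definition L2_sums :: "(nat \<Rightarrow> real \<Rightarrow> complex) \<Rightarrow> (real \<Rightarrow> complex) \<Rightarrow> bool"
  where "L2_sums u g \<longleftrightarrow>
    g \<in> L2_unit \<and> (\<lambda>M. L2_norm (\<lambda>x. (\<Sum>n<M. u n x) - g x)) \<longlonglongrightarrow> 0"

text \<open>
  The \<open>L\<^sup>2\<close> sum is determined only up to a null set; the choice operator picks one
  representative of the class.
\<close>

definition walsh_inverse :: "nat \<Rightarrow> complex mat \<Rightarrow> (nat \<Rightarrow> complex) \<Rightarrow> real \<Rightarrow> complex"
  where "walsh_inverse N C a = (SOME g. L2_sums (\<lambda>n x. a n * walsh N C n x) g)"

end

theory Submission
  imports Defs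
begin

text \<open>
  Write \<open>W\<^sub>n\<close> for the Walsh functions of one matrix \<open>C\<close>, and call a function that is constant on
  the \<open>N ^ q\<close> cells of length \<open>1 / N ^ q\<close> a step function of level \<open>q\<close>.  On \<open>[0,1)\<close> the value
  \<open>W\<^sub>n(x)\<close> with \<open>n < N ^ q\<close> is a product over \<open>k < q\<close> of entries of \<open>\<surd>N C\<close>: the row
  is the digit of \<open>n\<close> of weight \<open>N ^ k\<close>, the column is the digit of \<open>x\<close> of weight \<open>1 / N ^ (k + 1)\<close>.
  Summing over \<open>n < N ^ q\<close> therefore
  factors into \<open>q\<close> sums over rows, and orthonormality of the columns of \<open>C\<close> gives the kernel identity
  (\<open>walsh_kernel\<close>): \<open>\<Sum>n<N ^ q. W\<^sub>n(x) cnj(W\<^sub>n(y))\<close> is \<open>N ^ q\<close> if \<open>x\<close> and \<open>y\<close> lie in the same cell,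
  and \<open>0\<close> otherwise.  Integrating a step function \<open>g\<close> of level \<open>q\<close> against this kernel averages \<open>g\<close>
  over a cell, so \<open>g = (\<Sum>n<N ^ q. \<langle>g, W\<^sub>n\<rangle> W\<^sub>n)\<close> on \<open>[0,1)\<close> (\<open>walsh_expansion\<close>).

  The coefficients with \<open>n \<ge> N ^ q\<close> vanish (\<open>walsh_coefficient_vanishes\<close>): since \<open>g\<close> is also a step
  function of every higher level \<open>p\<close>, the sums of \<open>\<bar>\<langle>g, W\<^sub>n\<rangle>\<bar>\<^sup>2\<close> over \<open>n < N ^ p\<close> and over
  \<open>n < N ^ q\<close> both equal \<open>\<parallel>g\<parallel>\<^sup>2\<close>.  Hence the transforms in the theorem produce
  finitely supported sequences, and the chosen representative of the inverse transform agrees almost everywhere with a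
  finite Walsh sum (\<open>walsh_inverse_finite\<close>).

  Let \<open>T\<close> be the map \<open>g \<mapsto> (\<Sum>n<N ^ q. \<langle>g, A\<^sub>n\<rangle> B\<^sub>n)\<close>, where \<open>A\<^sub>n\<close>, \<open>B\<^sub>n\<close> are the
  Walsh functions of the two matrices.  Then
  \<open>T (T f) = (\<Sum>m. \<langle>f, A\<^sub>m\<rangle> (\<Sum>n. \<langle>B\<^sub>m, A\<^sub>n\<rangle> B\<^sub>n))\<close>.  The symmetry hypothesis replaces
  \<open>\<langle>B\<^sub>m, A\<^sub>n\<rangle>\<close> by \<open>\<langle>A\<^sub>m, B\<^sub>n\<rangle>\<close>, so the inner sum is the expansion of \<open>A\<^sub>m\<close> in the \<open>B\<^sub>n\<close>,
  and what remains is the expansion of \<open>f\<close> in the \<open>A\<^sub>m\<close>.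
\<close>

section \<open>Step functions on equal cells\<close>

text \<open>
  Cells are compared through floors because the base-\<open>N\<close> digits of a point are floors as well.  The
  domain is \<open>[0,1)\<close>: nothing is known at the null point \<open>1\<close>, which belongs to none of the cells.
\<close>
definition step_on :: "nat \<Rightarrow> (real \<Rightarrow> complex) \<Rightarrow> bool"
  where "step_on D g \<longleftrightarrow>
    (\<forall>x\<in>{0..<1}. \<forall>y\<in>{0..<1}. \<lfloor>real D * x\<rfloor> = \<lfloor>real D * y\<rfloor> \<longrightarrow> g x = g y)"

lemma step_onD:
  "step_on D g \<Longrightarrow> x \<in> {0..<1} \<Longrightarrow> y \<in> {0..<1} \<Longrightarrow> \<lfloor>real D * x\<rfloor> = \<lfloor>real D * y\<rfloor> \<Longrightarrow> g x = g y"
  unfolding step_on_def by blast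

lemma step_on_mult: "step_on D g \<Longrightarrow> step_on D h \<Longrightarrow> step_on D (\<lambda>x. g x * h x)"
  unfolding step_on_def by metis

lemma step_on_cnj: "step_on D g \<Longrightarrow> step_on D (\<lambda>x. cnj (g x))"
  unfolding step_on_def by metis

lemma step_on_cmult: "step_on D g \<Longrightarrow> step_on D (\<lambda>x. c * g x)"
  unfolding step_on_def by metis

lemma step_on_sum: "(\<And>n. n \<in> I \<Longrightarrow> step_on D (u n)) \<Longrightarrow> step_on D (\<lambda>x. \<Sum>n\<in>I. u n x)"
  unfolding step_on_def by (blast intro: sum.cong)

lemma step_on_cmod_sq: "step_on D g \<Longrightarrow> step_on D (\<lambda>x. complex_of_real ((cmod (g x))\<^sup>2))"
  unfolding step_on_def by metis

lemma floor_eq_coarsen: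
  fixes x y :: real
  assumes "\<lfloor>real (D * k) * x\<rfloor> = \<lfloor>real (D * k) * y\<rfloor>" "k > 0"
  shows "\<lfloor>real D * x\<rfloor> = \<lfloor>real D * y\<rfloor>"
proof -
  have *: "\<lfloor>real D * z\<rfloor> = \<lfloor>real (D * k) * z\<rfloor> div int k" for z :: real
    using floor_divide_real_eq_div[of "int k" "real (D * k) * z"] \<open>k > 0\<close> by (simp add: field_simps)
  show ?thesis by (simp only: * assms(1))
qed

lemma step_on_refine: "step_on D g \<Longrightarrow> k > 0 \<Longrightarrow> step_on (D * k) g"
  unfolding step_on_def using floor_eq_coarsen by blast

lemma floor_cell:
  assumes "D > 0" "(x::real) \<in> {0..<1}"
  shows "\<lfloor>real D * x\<rfloor> \<in> {0..<int D}"
  using assms by (auto simp: floor_less_iff)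

lemma mem_cell_iff:
  assumes "D > 0"
  shows "x \<in> {of_int j / real D ..< (of_int j + 1) / real D} \<longleftrightarrow> \<lfloor>real D * x\<rfloor> = j"
  using assms by (auto simp: field_simps floor_eq_iff)

lemma step_on_eq_corner:
  assumes "step_on D g" "D > 0" "x \<in> {0..<1}"
  shows "g x = g (of_int \<lfloor>real D * x\<rfloor> / real D)"
proof (rule step_onD[OF assms(1,3)])
  show "of_int \<lfloor>real D * x\<rfloor> / real D \<in> {0..<1}"
    using floor_cell[OF assms(2,3)] assms(2) by (simp add: field_simps)
  show "\<lfloor>real D * x\<rfloor> = \<lfloor>real D * (of_int \<lfloor>real D * x\<rfloor> / real D)\<rfloor>"
    using assms(2) by simp
qed

lemma borel_measurable_unit_lebesgueI:
  "f \<in> borel \<rightarrow>\<^sub>M M \<Longrightarrow> f \<in> unit_lebesgue \<rightarrow>\<^sub>M M"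
  by (intro measurable_restrict_space1 measurable_completion) simp

lemma step_on_measurable:
  assumes "step_on D g" "D > 0"
  shows "g \<in> borel_measurable unit_lebesgue"
proof -
  \<comment> \<open>A Borel function on the whole line that agrees with \<open>g\<close> on \<open>[0,1]\<close>; off \<open>[0,1]\<close> nothing is
     known about \<open>g\<close>.\<close>
  define h where "h x = (if x = 1 then g 1 else (\<lambda>j. g (of_int j / real D)) \<lfloor>real D * x\<rfloor>)" for x
  have 1: "(\<lambda>x. \<lfloor>real D * x\<rfloor>) \<in> borel \<rightarrow>\<^sub>M count_space UNIV"
    by measurable
  have "(\<lambda>x. g (of_int \<lfloor>real D * x\<rfloor> / real D)) \<in> borel_measurable borel"
    by (rule measurable_compose[OF 1]) simp
  then have "h \<in> borel_measurable borel"
    unfolding h_def by measurable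
  then have "h \<in> borel_measurable unit_lebesgue"
    by (rule borel_measurable_unit_lebesgueI)
  moreover have "g x = h x" if "x \<in> space unit_lebesgue" for x
    using step_on_eq_corner[OF assms, of x] that by (auto simp: h_def)
  ultimately show ?thesis
    using measurable_cong[of unit_lebesgue g h] by blast
qed

lemma finite_measure_unit: "finite_measure unit_lebesgue"
  by (rule finite_measure_lebesgue_on) simp

lemma AE_unit_lebesgueI:
  assumes "\<And>x. x \<in> {0..<1} \<Longrightarrow> P x"
  shows "AE x in unit_lebesgue. P x"
proof (rule AE_I')
  show "{1} \<in> null_sets unit_lebesgue"
    by (auto simp: null_sets_def emeasure_restrict_space sets_restrict_space)
  show "{x \<in> space unit_lebesgue. \<not> P x} \<subseteq> {1}"
    using assms by force
qed

lemma step_on_integrable: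
  assumes "step_on D g" "D > 0"
  shows "integrable unit_lebesgue g"
proof -
  interpret finite_measure unit_lebesgue by (rule finite_measure_unit)
  have "g ` {0..<1} \<subseteq> (\<lambda>j. g (of_int j / real D)) ` {0..<int D}"
    using step_on_eq_corner[OF assms] floor_cell[OF assms(2)] by blast
  then have "finite (g ` {0..<1})"
    by (rule finite_subset) simp
  then obtain M where M: "\<And>x. x \<in> {0..<1} \<Longrightarrow> cmod (g x) \<le> M"
    using finite_imp_bounded[of "g ` {0..<1}"] unfolding bounded_iff by blast
  show ?thesis
    by (rule integrable_const_bound[of _ M])
       (rule AE_unit_lebesgueI[OF M] step_on_measurable[OF assms] | assumption)+
qed

lemma step_on_L2:
  assumes "step_on D g" "D > 0"
  shows "g \<in> L2_unit"
proof -
  have "integrable unit_lebesgue (\<lambda>x. Re (complex_of_real ((cmod (g x))\<^sup>2)))"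
    by (rule integrable_Re[OF step_on_integrable[OF step_on_cmod_sq[OF assms(1)] assms(2)]])
  then show ?thesis
    using step_on_measurable[OF assms] by (simp add: L2_unit_def)
qed

lemma L2_inner_AE_cong:
  assumes "AE x in unit_lebesgue. g x = h x"
    "g \<in> borel_measurable unit_lebesgue" "h \<in> borel_measurable unit_lebesgue"
    "w \<in> borel_measurable unit_lebesgue"
  shows "L2_inner g w = L2_inner h w"
  unfolding L2_inner_def
proof (rule integral_cong_AE)
  have *: "cnj \<in> borel_measurable borel"
    by (intro borel_measurable_continuous_onI continuous_intros)
  then have "(\<lambda>x. cnj (w x)) \<in> borel_measurable unit_lebesgue"
    using assms(4) by (rule measurable_compose[rotated])
  then show "(\<lambda>x. g x * cnj (w x)) \<in> borel_measurable unit_lebesgue"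
      "(\<lambda>x. h x * cnj (w x)) \<in> borel_measurable unit_lebesgue"
    using assms by measurable
  show "AE x in unit_lebesgue. g x * cnj (w x) = h x * cnj (w x)"
    using assms(1) by eventually_elim simp
qed

text \<open>
  The factor equal to \<open>D\<close> on the cell of \<open>x\<close> has integral \<open>1\<close>, so the integral is the mean of \<open>g\<close>
  over that cell.
\<close>
lemma step_on_integral_cell:
  assumes "step_on D g" "D > 0" "x \<in> {0..<1}"
  shows "integral\<^sup>L unit_lebesgue
      (\<lambda>y. g y * (if \<lfloor>real D * x\<rfloor> = \<lfloor>real D * y\<rfloor> then of_nat D else 0)) = g x"
proof -
  define j where "j = \<lfloor>real D * x\<rfloor>"
  define S where "S = {of_int j / real D ..< (of_int j + 1) / real D}"
  have j: "0 \<le> j" "j + 1 \<le> int D"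
    using floor_cell[OF assms(2,3)] by (auto simp: j_def)
  then have j': "0 \<le> real_of_int j" "real_of_int j + 1 \<le> real D"
    by linarith+
  have S01: "S \<subseteq> {0..1}"
  proof
    fix y assume "y \<in> S"
    then have "of_int j \<le> real D * y" "real D * y < of_int j + 1"
      using assms(2) by (auto simp: S_def field_simps)
    then have "0 \<le> real D * y" "real D * y \<le> real D * 1"
      using j' by linarith+
    then show "y \<in> {0..1}"
      using assms(2) by (auto simp: zero_le_mult_iff)
  qed
  have inS: "y \<in> S \<longleftrightarrow> j = \<lfloor>real D * y\<rfloor>" for y
    using mem_cell_iff[OF assms(2)] unfolding S_def by auto
  have "step_on D (\<lambda>y. if j = \<lfloor>real D * y\<rfloor> then of_nat D else 0)"
    unfolding step_on_def by simp
  note meas = step_on_measurable[OF step_on_mult[OF assms(1) this] assms(2)]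
  have Smeas: "S \<in> sets unit_lebesgue"
    using S01 by (auto simp: sets_restrict_space S_def)
  have "integral\<^sup>L unit_lebesgue (\<lambda>y. g y * (if j = \<lfloor>real D * y\<rfloor> then of_nat D else 0))
      = integral\<^sup>L unit_lebesgue (\<lambda>y. indicator S y *\<^sub>R (of_nat D * g x))"
  proof (rule integral_cong_AE[OF meas])
    show "(\<lambda>y. indicator S y *\<^sub>R (of_nat D * g x)) \<in> borel_measurable unit_lebesgue"
      using Smeas by measurable
    show "AE y in unit_lebesgue. g y * (if j = \<lfloor>real D * y\<rfloor> then of_nat D else 0)
        = indicator S y *\<^sub>R (of_nat D * g x)"
      by (rule AE_unit_lebesgueI)
         (use step_onD[OF assms(1,3)] in \<open>auto simp: indicator_def inS j_def\<close>)
  qed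
  also have "\<dots> = measure unit_lebesgue S *\<^sub>R (of_nat D * g x)"
    using finite_measure.emeasure_finite[OF finite_measure_unit, of S]
    by (intro has_bochner_integral_integral_eq has_bochner_integral_indicator Smeas)
       (simp add: less_top)
  also have "measure unit_lebesgue S = measure lborel S"
    using S01 by (subst measure_restrict_space) (auto simp: S_def)
  also have "\<dots> = 1 / real D"
    using assms(2) by (simp add: S_def field_simps)
  also have "(1 / real D) *\<^sub>R (of_nat D * g x) = g x"
    using assms(2) by (simp add: scaleR_conv_of_real)
  finally show ?thesis by (simp add: j_def)
qed

section \<open>Walsh functions as products over digits\<close>

locale walsh_system =
  fixes N :: nat and C :: "complex mat"
  assumes N_gt_1: "N > 1"
    and unitary: "unitary_mat N C"
    and first_row: "\<And>j. j < N \<Longrightarrow> C $$ (0, j) = 1 / complex_of_real (sqrt (real N))"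
begin

lemma N_pos: "N > 0" using N_gt_1 by simp

lemma index_less_power: "n < N ^ n"
  using N_gt_1 by (metis less_exp less_le_trans power_mono Suc_1 Suc_leI zero_le)

lemma walsh_pow_pos: "N ^ q > 0" using N_pos by simp

lemma columns_orthonormal:
  assumes "j < N" "k < N"
  shows "(\<Sum>i<N. C $$ (i, j) * cnj (C $$ (i, k))) = (if j = k then 1 else 0)"
proof -
  have C: "C \<in> carrier_mat N N" and U: "mat_adjoint C * C = 1\<^sub>m N"
    using unitary by (auto simp: unitary_mat_def)
  have "(mat_adjoint C * C) $$ (k, j) = (\<Sum>i<N. cnj (C $$ (i, k)) * C $$ (i, j))"
    using C assms by (auto simp: mat_adjoint_def scalar_prod_def atLeast0LessThan mat_of_rows_def)
  then show ?thesis
    using U assms by (auto simp: mult.commute)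
qed

text \<open>The leading base-\<open>N\<close> digit of a point of \<open>[0,1)\<close>.\<close>
definition digit :: "real \<Rightarrow> nat"
  where "digit x = nat \<lfloor>real N * x\<rfloor>"

lemma digit_less: "x \<in> {0..<1} \<Longrightarrow> digit x < N"
  using floor_cell[OF N_pos, of x] by (simp add: digit_def nat_less_iff)

lemma filter_eq:
  assumes "x \<in> {0..<1}"
  shows "walsh_filter N C i x = complex_of_real (sqrt (real N)) * C $$ (i, digit x)"
proof -
  have "x \<in> {real j / real N ..< (real j + 1) / real N} \<longleftrightarrow> j = digit x" for j
  proof -
    have "x \<in> {real j / real N ..< (real j + 1) / real N} \<longleftrightarrow> \<lfloor>real N * x\<rfloor> = int j"
      using mem_cell_iff[OF N_pos, of x "int j"] by simp
    also have "\<dots> \<longleftrightarrow> j = digit x"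
      using floor_cell[OF N_pos assms] by (auto simp: digit_def)
    finally show ?thesis .
  qed
  then have "(\<Sum>j<N. C $$ (i, j) * indicator {real j / real N ..< (real j + 1) / real N} x)
      = (\<Sum>j<N. if j = digit x then C $$ (i, j) else 0)"
    by (intro sum.cong) (auto simp: indicator_def)
  also have "\<dots> = C $$ (i, digit x)"
    using digit_less[OF assms] by simp
  finally show ?thesis
    using assms by (simp add: walsh_filter_def)
qed

lemma filter_0: "x \<in> {0..<1} \<Longrightarrow> walsh_filter N C 0 x = 1"
  using digit_less[of x] N_pos by (simp add: filter_eq first_row)

lemma filter_kernel:
  assumes "x \<in> {0..<1}" "y \<in> {0..<1}"
  shows "(\<Sum>i<N. walsh_filter N C i x * cnj (walsh_filter N C i y))
    = (if digit x = digit y then of_nat N else 0)"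
proof -
  have s: "complex_of_real (sqrt (real N)) * complex_of_real (sqrt (real N)) = of_nat N"
    by (simp flip: of_real_mult)
  have "(\<Sum>i<N. walsh_filter N C i x * cnj (walsh_filter N C i y))
      = of_nat N * (\<Sum>i<N. C $$ (i, digit x) * cnj (C $$ (i, digit y)))"
    unfolding filter_eq[OF assms(1)] filter_eq[OF assms(2)] s[symmetric] sum_distrib_left
    by (intro sum.cong refl) (simp add: mult_ac)
  then show ?thesis
    using columns_orthonormal[OF digit_less[OF assms(1)] digit_less[OF assms(2)]] by simp
qed

lemma shift_iterate:
  assumes "x \<in> {0..<1}"
  shows "(walsh_shift N ^^ k) x = frac (real (N ^ k) * x)"
proof (induction k)
  case 0
  then show ?case using assms by (simp add: frac_eq)
next
  case (Suc k)
  have ne: "frac (real (N ^ k) * x) \<noteq> 1"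
    using frac_lt_1[of "real (N ^ k) * x"] by linarith
  have "real N * frac (real (N ^ k) * x)
      = real (N ^ Suc k) * x + of_int (- int N * \<lfloor>real (N ^ k) * x\<rfloor>)"
    by (simp add: frac_def algebra_simps)
  then have "frac (real N * frac (real (N ^ k) * x)) = frac (real (N ^ Suc k) * x)"
    by (simp only: frac_add_of_int_right)
  then show ?case
    unfolding funpow.simps comp_apply Suc.IH using ne by (simp add: walsh_shift_def)
qed

lemma shift_in: "x \<in> {0..<1} \<Longrightarrow> (walsh_shift N ^^ k) x \<in> {0..<1}"
  by (simp add: shift_iterate frac_lt_1)

text \<open>
  Both sides say that the first \<open>k + 1\<close> base-\<open>N\<close> digits of the points agree; the leading digit of the
  \<open>k\<close>-fold shift is the last of them.
\<close>
lemma cell_Suc_iff: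
  assumes "x \<in> {0..<1}" "y \<in> {0..<1}"
  shows "\<lfloor>real (N ^ Suc k) * x\<rfloor> = \<lfloor>real (N ^ Suc k) * y\<rfloor> \<longleftrightarrow>
    \<lfloor>real (N ^ k) * x\<rfloor> = \<lfloor>real (N ^ k) * y\<rfloor> \<and>
    digit ((walsh_shift N ^^ k) x) = digit ((walsh_shift N ^^ k) y)"
proof -
  have split: "\<lfloor>real (N ^ Suc k) * z\<rfloor>
      = int N * \<lfloor>real (N ^ k) * z\<rfloor> + int (digit ((walsh_shift N ^^ k) z))"
    if "z \<in> {0..<1}" for z
  proof -
    have "real (N ^ Suc k) * z
        = real N * frac (real (N ^ k) * z) + of_int (int N * \<lfloor>real (N ^ k) * z\<rfloor>)"
      by (simp add: frac_def algebra_simps)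
    then have "\<lfloor>real (N ^ Suc k) * z\<rfloor>
        = \<lfloor>real N * frac (real (N ^ k) * z)\<rfloor> + int N * \<lfloor>real (N ^ k) * z\<rfloor>"
      by (simp only: floor_add_int)
    moreover have "0 \<le> \<lfloor>real N * frac (real (N ^ k) * z)\<rfloor>" by simp
    ultimately show ?thesis
      using that by (simp add: digit_def shift_iterate)
  qed
  have "\<lfloor>real (N ^ k) * x\<rfloor> = \<lfloor>real (N ^ k) * y\<rfloor>"
    if "\<lfloor>real (N ^ Suc k) * x\<rfloor> = \<lfloor>real (N ^ Suc k) * y\<rfloor>"
    using floor_eq_coarsen[of "N ^ k" N x y] that N_pos by (simp add: mult.commute)
  then show ?thesis
    using split[OF assms(1)] split[OF assms(2)] by auto
qed

text \<open>
  Leading zero digits of \<open>n\<close> contribute the constant filter \<open>m\<^sub>0 = 1\<close>, so all indices below \<open>N ^ q\<close>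
  can be given the same number \<open>q\<close> of factors.
\<close>
lemma walsh_padded:
  assumes "n < N ^ q" "x \<in> {0..<1}"
  shows "walsh N C n x
    = (\<Prod>k<q. walsh_filter N C ((n div N ^ k) mod N) ((walsh_shift N ^^ k) x))"
  unfolding walsh_def
proof (rule prod.mono_neutral_left)
  show "{..<floorlog N n} \<subseteq> {..<q}"
    using floorlog_leI[OF assms(1) _ N_gt_1] N_gt_1 by auto
  show "\<forall>k\<in>{..<q} - {..<floorlog N n}.
      walsh_filter N C (n div N ^ k mod N) ((walsh_shift N ^^ k) x) = 1"
  proof
    fix k assume "k \<in> {..<q} - {..<floorlog N n}"
    then have "n < N ^ k"
      using floorlog_ge_SucI[of N k n] N_gt_1 by (auto simp: not_less Suc_le_eq intro: leI)
    then show "walsh_filter N C (n div N ^ k mod N) ((walsh_shift N ^^ k) x) = 1"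
      using filter_0[OF shift_in[OF assms(2)]] by simp
  qed
qed simp

lemma walsh_step: "n < N ^ q \<Longrightarrow> step_on (N ^ q) (walsh N C n)"
proof (unfold step_on_def, intro ballI impI)
  fix x y :: real
  assume n: "n < N ^ q" and xy: "x \<in> {0..<1}" "y \<in> {0..<1}"
    and eq: "\<lfloor>real (N ^ q) * x\<rfloor> = \<lfloor>real (N ^ q) * y\<rfloor>"
  have "\<forall>k<q. digit ((walsh_shift N ^^ k) x) = digit ((walsh_shift N ^^ k) y)"
    using eq
  proof (induction q)
    case (Suc q)
    then show ?case
      using cell_Suc_iff[OF xy, of q] less_Suc_eq by auto
  qed simp
  then show "walsh N C n x = walsh N C n y"
    unfolding walsh_padded[OF n xy(1)] walsh_padded[OF n xy(2)]
      filter_eq[OF shift_in[OF xy(1)]] filter_eq[OF shift_in[OF xy(2)]]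
    by (intro prod.cong) auto
qed

lemma walsh_split:
  assumes "a < N ^ q" "b < N" "x \<in> {0..<1}"
  shows "walsh N C (b * N ^ q + a) x = walsh N C a x * walsh_filter N C b ((walsh_shift N ^^ q) x)"
proof -
  have "b * N ^ q + a < Suc b * N ^ q"
    using assms(1) by simp
  also have "\<dots> \<le> N ^ Suc q"
    using assms(2) by (simp only: power_Suc) (intro mult_right_mono, auto)
  finally have lt: "b * N ^ q + a < N ^ Suc q" .
  have low: "(b * N ^ q + a) div N ^ k mod N = a div N ^ k mod N" if "k < q" for k
  proof -
    have e: "b * N ^ q = N ^ k * (N * (b * N ^ (q - Suc k)))"
      using that by (simp flip: power_add power_Suc add: mult.assoc mult.left_commute)
    have "N ^ k \<noteq> 0" using N_pos by simp
    then show ?thesis unfolding e by simp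
  qed
  have high: "(b * N ^ q + a) div N ^ q mod N = b"
    using assms by simp
  show ?thesis
    by (simp add: walsh_padded[OF lt assms(3)] walsh_padded[OF assms(1,3)] low high
        del: power_Suc mult_Suc)
qed

text \<open>
  Splitting off the top digit of \<open>n\<close> factors the sum of level \<open>q + 1\<close> into the sum of level \<open>q\<close> and a
  sum over the rows of \<open>C\<close>, which tests whether the next digits of \<open>x\<close> and \<open>y\<close> agree.
\<close>
lemma walsh_kernel:
  assumes "x \<in> {0..<1}" "y \<in> {0..<1}"
  shows "(\<Sum>n<N ^ q. walsh N C n x * cnj (walsh N C n y))
    = (if \<lfloor>real (N ^ q) * x\<rfloor> = \<lfloor>real (N ^ q) * y\<rfloor> then of_nat (N ^ q) else 0)"
proof (induction q)
  case 0
  have "\<lfloor>x\<rfloor> = 0" "\<lfloor>y\<rfloor> = 0" using assms by (auto simp: floor_eq_iff)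
  then show ?case by (simp add: walsh_def floorlog_def)
next
  case (Suc q)
  let ?K = "\<lambda>n. walsh N C n x * cnj (walsh N C n y)"
  let ?m = "\<lambda>b z. walsh_filter N C b ((walsh_shift N ^^ q) z)"
  have "(\<Sum>n<N ^ Suc q. ?K n) = (\<Sum>b<N. sum ?K {b * N ^ q..<b * N ^ q + N ^ q})"
    by (simp add: sum.nat_group)
  also have "\<dots> = (\<Sum>b<N. \<Sum>a<N ^ q. ?K (b * N ^ q + a))"
    by (simp add: sum.atLeastLessThan_shift_0 atLeast0LessThan)
  also have "\<dots> = (\<Sum>b<N. \<Sum>a<N ^ q. ?K a * (?m b x * cnj (?m b y)))"
    by (intro sum.cong refl)
       (simp add: walsh_split[OF _ _ assms(1)] walsh_split[OF _ _ assms(2)] mult_ac)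
  also have "\<dots> = (\<Sum>a<N ^ q. ?K a) * (\<Sum>b<N. ?m b x * cnj (?m b y))"
    by (simp add: sum_product sum.swap[of _ "{..<N}"])
  also have "(\<Sum>b<N. ?m b x * cnj (?m b y)) = (if digit ((walsh_shift N ^^ q) x)
      = digit ((walsh_shift N ^^ q) y) then of_nat N else 0)"
    using assms by (intro filter_kernel shift_in)
  finally show ?case
    using cell_Suc_iff[OF assms, of q] by (simp add: Suc mult.commute)
qed

section \<open>Expansion of step functions\<close>

lemma inner_integrable:
  assumes "step_on (N ^ q) g" "n < N ^ q"
  shows "integrable unit_lebesgue (\<lambda>y. g y * cnj (walsh N C n y))"
  using assms by (intro step_on_integrable[OF _ walsh_pow_pos] step_on_mult step_on_cnj walsh_step)

text \<open>
  The left-hand side is the integral of \<open>g\<close> against the kernel at \<open>x\<close>, that is, the mean of \<open>g\<close> over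
  the cell of \<open>x\<close>.
\<close>
lemma walsh_expansion:
  assumes g: "step_on (N ^ q) g" and x: "x \<in> {0..<1}"
  shows "(\<Sum>n<N ^ q. L2_inner g (walsh N C n) * walsh N C n x) = g x"
proof -
  have int: "integrable unit_lebesgue (\<lambda>y. g y * cnj (walsh N C n y) * walsh N C n x)"
    if "n < N ^ q" for n
    using inner_integrable[OF g that] by simp
  have st: "step_on (N ^ q) (\<lambda>y. if \<lfloor>real (N ^ q) * x\<rfloor> = \<lfloor>real (N ^ q) * y\<rfloor>
        then of_nat (N ^ q) else 0)"
    unfolding step_on_def by simp
  have "(\<Sum>n<N ^ q. L2_inner g (walsh N C n) * walsh N C n x)
      = integral\<^sup>L unit_lebesgue (\<lambda>y. \<Sum>n<N ^ q. g y * cnj (walsh N C n y) * walsh N C n x)"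
    using int inner_integrable[OF g] by (simp add: L2_inner_def)
  also have "\<dots> = integral\<^sup>L unit_lebesgue (\<lambda>y. g y *
      (if \<lfloor>real (N ^ q) * x\<rfloor> = \<lfloor>real (N ^ q) * y\<rfloor> then of_nat (N ^ q) else 0))"
  proof (rule integral_cong_AE)
    show "(\<lambda>y. \<Sum>n<N ^ q. g y * cnj (walsh N C n y) * walsh N C n x)
        \<in> borel_measurable unit_lebesgue"
      using int by (intro borel_measurable_sum) auto
    show "(\<lambda>y. g y * (if \<lfloor>real (N ^ q) * x\<rfloor> = \<lfloor>real (N ^ q) * y\<rfloor>
        then of_nat (N ^ q) else 0)) \<in> borel_measurable unit_lebesgue"
      by (rule step_on_measurable[OF step_on_mult[OF g st] walsh_pow_pos])
    show "AE y in unit_lebesgue. (\<Sum>n<N ^ q. g y * cnj (walsh N C n y) * walsh N C n x)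
        = g y * (if \<lfloor>real (N ^ q) * x\<rfloor> = \<lfloor>real (N ^ q) * y\<rfloor> then of_nat (N ^ q) else 0)"
    proof (rule AE_unit_lebesgueI)
      fix y :: real assume "y \<in> {0..<1}"
      from walsh_kernel[OF x this, of q, symmetric]
      show "(\<Sum>n<N ^ q. g y * cnj (walsh N C n y) * walsh N C n x)
        = g y * (if \<lfloor>real (N ^ q) * x\<rfloor> = \<lfloor>real (N ^ q) * y\<rfloor> then of_nat (N ^ q) else 0)"
        by (simp only: sum_distrib_left) (simp add: mult_ac)
    qed
  qed
  also have "\<dots> = g x"
    by (rule step_on_integral_cell[OF g walsh_pow_pos x])
  finally show ?thesis .
qed

text \<open>Obtained by integrating the conjugated expansion of \<open>g\<close> against \<open>g\<close> itself.\<close>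
lemma walsh_parseval:
  assumes g: "step_on (N ^ q) g"
  shows "(\<Sum>n<N ^ q. (cmod (L2_inner g (walsh N C n)))\<^sup>2)
    = integral\<^sup>L unit_lebesgue (\<lambda>y. (cmod (g y))\<^sup>2)"
proof -
  define c where "c n = L2_inner g (walsh N C n)" for n
  have int: "integrable unit_lebesgue (\<lambda>y. cnj (c n) * (g y * cnj (walsh N C n y)))"
    if "n < N ^ q" for n
    using inner_integrable[OF g that] by simp
  have "complex_of_real (\<Sum>n<N ^ q. (cmod (c n))\<^sup>2) = (\<Sum>n<N ^ q. cnj (c n) * c n)"
    by (simp add: complex_norm_square mult.commute del: of_real_power)
  also have "\<dots> = integral\<^sup>L unit_lebesgue
      (\<lambda>y. \<Sum>n<N ^ q. cnj (c n) * (g y * cnj (walsh N C n y)))"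
    using int inner_integrable[OF g] by (simp add: c_def L2_inner_def)
  also have "\<dots> = integral\<^sup>L unit_lebesgue (\<lambda>y. complex_of_real ((cmod (g y))\<^sup>2))"
  proof (rule integral_cong_AE)
    show "(\<lambda>y. \<Sum>n<N ^ q. cnj (c n) * (g y * cnj (walsh N C n y))) \<in> borel_measurable unit_lebesgue"
      using int by (intro borel_measurable_sum) auto
    show "(\<lambda>y. complex_of_real ((cmod (g y))\<^sup>2)) \<in> borel_measurable unit_lebesgue"
      by (rule step_on_measurable[OF step_on_cmod_sq[OF g] walsh_pow_pos])
    show "AE y in unit_lebesgue. (\<Sum>n<N ^ q. cnj (c n) * (g y * cnj (walsh N C n y)))
        = complex_of_real ((cmod (g y))\<^sup>2)"
    proof (rule AE_unit_lebesgueI)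
      fix y :: real assume "y \<in> {0..<1}"
      then have "cnj (g y) = (\<Sum>n<N ^ q. cnj (c n) * cnj (walsh N C n y))"
        by (subst walsh_expansion[OF g, symmetric]) (auto simp: c_def)
      then have "g y * cnj (g y) = (\<Sum>n<N ^ q. cnj (c n) * (g y * cnj (walsh N C n y)))"
        by (simp add: sum_distrib_left mult_ac)
      then show "(\<Sum>n<N ^ q. cnj (c n) * (g y * cnj (walsh N C n y)))
          = complex_of_real ((cmod (g y))\<^sup>2)"
        by (simp add: complex_norm_square del: of_real_power)
    qed
  qed
  also have "\<dots> = complex_of_real (integral\<^sup>L unit_lebesgue (\<lambda>y. (cmod (g y))\<^sup>2))"
    by (rule integral_complex_of_real)
  finally show ?thesis
    unfolding c_def of_real_eq_iff .
qed

text \<open>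
  Parseval's identity holds for \<open>g\<close> at level \<open>q\<close> and at every finer level, with the same right-hand
  side; so the squared moduli of the coefficients that the finer level adds sum to \<open>0\<close>.
\<close>
lemma walsh_coefficient_vanishes:
  assumes g: "step_on (N ^ q) g" and n: "n \<ge> N ^ q"
  shows "L2_inner g (walsh N C n) = 0"
proof -
  let ?s = "\<lambda>n. (cmod (L2_inner g (walsh N C n)))\<^sup>2"
  define p where "p = q + n"
  have g': "step_on (N ^ p) g"
    using step_on_refine[OF g walsh_pow_pos, of n] by (simp add: p_def power_add)
  have "n < N ^ n" by (rule index_less_power)
  also have "\<dots> \<le> N ^ p"
    using N_gt_1 by (intro power_increasing) (auto simp: p_def)
  finally have np: "n \<in> {..<N ^ p} - {..<N ^ q}" using n by simp
  have sub: "{..<N ^ q} \<subseteq> {..<N ^ p}"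
    using n np by auto
  have "sum ?s ({..<N ^ p} - {..<N ^ q}) = 0"
    using walsh_parseval[OF g] walsh_parseval[OF g'] sum_diff[OF _ sub, of ?s] by simp
  then have "?s n = 0"
    using np by (subst (asm) sum_nonneg_eq_0_iff) auto
  then show ?thesis by simp
qed

lemma walsh_L2: "walsh N C n \<in> L2_unit"
proof -
  have "n < N ^ n" by (rule index_less_power)
  then show ?thesis
    by (intro step_on_L2[OF walsh_step walsh_pow_pos])
qed

text \<open>
  The partial sums are eventually equal to one finite sum \<open>S\<close>, so \<open>S\<close> is an \<open>L\<^sup>2\<close> sum of the series
  and the representative that the choice operator picks is at \<open>L\<^sup>2\<close> distance \<open>0\<close> from it.
\<close>
lemma walsh_inverse_finite:
  assumes a: "\<And>n. n \<ge> N ^ q \<Longrightarrow> a n = 0"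
  shows "walsh_inverse N C a \<in> borel_measurable unit_lebesgue"
    and "AE x in unit_lebesgue. walsh_inverse N C a x = (\<Sum>n<N ^ q. a n * walsh N C n x)"
proof -
  let ?u = "\<lambda>n x. a n * walsh N C n x"
  define S where "S x = (\<Sum>n<N ^ q. ?u n x)" for x
  have tail: "(\<Sum>n<M. ?u n x) = S x" if "M \<ge> N ^ q" for M x
    unfolding S_def using that a by (intro sum.mono_neutral_right) auto
  have lim: "(\<lambda>M. L2_norm (\<lambda>x. (\<Sum>n<M. ?u n x) - g x)) \<longlonglongrightarrow> L2_norm (\<lambda>x. S x - g x)" for g
    by (rule tendsto_eventually, rule eventually_sequentiallyI[of "N ^ q"]) (simp add: tail)
  have "step_on (N ^ q) S"
    unfolding S_def by (intro step_on_sum step_on_cmult walsh_step) simp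
  then have S: "S \<in> L2_unit"
    by (rule step_on_L2[OF _ walsh_pow_pos])
  have "L2_sums ?u S"
    using S lim[of S] by (simp add: L2_sums_def L2_norm_def)
  then have "L2_sums ?u (walsh_inverse N C a)"
    unfolding walsh_inverse_def by (rule someI[of "L2_sums ?u"])
  then have g: "walsh_inverse N C a \<in> L2_unit"
    and l0: "(\<lambda>M. L2_norm (\<lambda>x. (\<Sum>n<M. ?u n x) - walsh_inverse N C a x)) \<longlonglongrightarrow> 0"
    by (auto simp: L2_sums_def)
  define h where "h = walsh_inverse N C a"
  have h: "h \<in> borel_measurable unit_lebesgue" "integrable unit_lebesgue (\<lambda>x. (cmod (h x))\<^sup>2)"
    and S': "S \<in> borel_measurable unit_lebesgue" "integrable unit_lebesgue (\<lambda>x. (cmod (S x))\<^sup>2)"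
    using g S by (auto simp: L2_unit_def h_def)
  show "walsh_inverse N C a \<in> borel_measurable unit_lebesgue"
    using h by (simp add: h_def)
  have "L2_norm (\<lambda>x. S x - h x) = 0"
    using LIMSEQ_unique[OF lim l0] by (simp add: h_def)
  then have zero: "integral\<^sup>L unit_lebesgue (\<lambda>x. (cmod (S x - h x))\<^sup>2) = 0"
    by (simp add: L2_norm_def)
  have "integrable unit_lebesgue (\<lambda>x. (cmod (S x - h x))\<^sup>2)"
  proof (rule Bochner_Integration.integrable_bound)
    show "integrable unit_lebesgue (\<lambda>x. 2 * (cmod (S x))\<^sup>2 + 2 * (cmod (h x))\<^sup>2)"
      using h S' by simp
    show "(\<lambda>x. (cmod (S x - h x))\<^sup>2) \<in> borel_measurable unit_lebesgue"
      using h(1) S'(1) by measurable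
    have "(cmod (S x - h x))\<^sup>2 \<le> 2 * (cmod (S x))\<^sup>2 + 2 * (cmod (h x))\<^sup>2" for x
    proof -
      have "(cmod (S x - h x))\<^sup>2 \<le> (cmod (S x) + cmod (h x))\<^sup>2"
        by (intro power_mono norm_triangle_ineq4) simp
      also have "\<dots> \<le> 2 * (cmod (S x))\<^sup>2 + 2 * (cmod (h x))\<^sup>2"
        using zero_le_power2[of "cmod (S x) - cmod (h x)"] by (simp add: power2_eq_square algebra_simps)
      finally show ?thesis .
    qed
    then show "AE x in unit_lebesgue. norm ((cmod (S x - h x))\<^sup>2)
        \<le> norm (2 * (cmod (S x))\<^sup>2 + 2 * (cmod (h x))\<^sup>2)"
      by simp
  qed
  then have "AE x in unit_lebesgue. (cmod (S x - h x))\<^sup>2 = 0"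
    using zero by (subst (asm) integral_nonneg_eq_0_iff_AE) auto
  then show "AE x in unit_lebesgue. walsh_inverse N C a x = (\<Sum>n<N ^ q. ?u n x)"
    by eventually_elim (simp add: S_def h_def)
qed

end

section \<open>Composing the two transforms\<close>

lemma constant_on_cells_imp_step_on:
  assumes "D > 0"
    and "\<And>i. i < D \<Longrightarrow> f constant_on {real i / real D ..< (real i + 1) / real D}"
  shows "step_on D f"
proof (unfold step_on_def, intro ballI impI)
  fix x y :: real
  assume x: "x \<in> {0..<1}" and y: "y \<in> {0..<1}" and eq: "\<lfloor>real D * x\<rfloor> = \<lfloor>real D * y\<rfloor>"
  define i where "i = nat \<lfloor>real D * x\<rfloor>"
  have i: "i < D" "\<lfloor>real D * x\<rfloor> = int i"
    using floor_cell[OF assms(1) x] by (simp_all add: i_def nat_less_iff)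
  then have "x \<in> {real i / real D ..< (real i + 1) / real D}"
      "y \<in> {real i / real D ..< (real i + 1) / real D}"
    using eq mem_cell_iff[OF assms(1), of _ "int i"] by simp_all
  then show "f x = f y"
    using assms(2)[OF i(1)] unfolding constant_on_def by metis
qed

lemma L2_inner_sum_left:
  assumes "\<And>m. m \<in> I \<Longrightarrow> integrable unit_lebesgue (\<lambda>y. u m y * cnj (w y))"
  shows "L2_inner (\<lambda>x. \<Sum>m\<in>I. c m * u m x) w = (\<Sum>m\<in>I. c m * L2_inner (u m) w)"
proof -
  have "L2_inner (\<lambda>x. \<Sum>m\<in>I. c m * u m x) w
      = integral\<^sup>L unit_lebesgue (\<lambda>y. \<Sum>m\<in>I. c m * (u m y * cnj (w y)))"
    by (simp add: L2_inner_def sum_distrib_right mult.assoc)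
  also have "\<dots> = (\<Sum>m\<in>I. c m * L2_inner (u m) w)"
    using assms by (simp add: L2_inner_def)
  finally show ?thesis .
qed

theorem proposition3p4:
  fixes q N :: nat and A B :: "complex mat" and f :: "real \<Rightarrow> complex"
  assumes "q \<ge> 1" and "N > 1"
    and "unitary_mat N A" and "unitary_mat N B"
    and "\<And>j. j < N \<Longrightarrow> A $$ (0, j) = 1 / complex_of_real (sqrt (real N))"
    and "\<And>j. j < N \<Longrightarrow> B $$ (0, j) = 1 / complex_of_real (sqrt (real N))"
    and "\<And>k l. k < N ^ q \<Longrightarrow> l < N ^ q \<Longrightarrow>
           L2_inner (walsh N B l) (walsh N A k) = L2_inner (walsh N A l) (walsh N B k)"
    and "\<And>i. i < N ^ q \<Longrightarrow>
           f constant_on {real i / real (N ^ q) ..< (real i + 1) / real (N ^ q)}"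
  shows "AE x in unit_lebesgue.
    (walsh_inverse N B \<circ> walsh_transform N A \<circ> walsh_inverse N B \<circ> walsh_transform N A) f x
      = f x"
proof -
  interpret A: walsh_system N A by unfold_locales (use assms in auto)
  interpret B: walsh_system N B by unfold_locales (use assms in auto)
  let ?D = "N ^ q"
  have f: "step_on ?D f"
    using assms(8) A.walsh_pow_pos by (rule constant_on_cells_imp_step_on[rotated])
  define S where "S x = (\<Sum>m<?D. walsh_transform N A f m * walsh N B m x)" for x
  define g where "g = walsh_inverse N B (walsh_transform N A f)"
  have S: "step_on ?D S"
    unfolding S_def by (intro step_on_sum step_on_cmult B.walsh_step) simp
  have f_tail: "walsh_transform N A f n = 0" if "n \<ge> ?D" for n
    unfolding walsh_transform_def by (rule A.walsh_coefficient_vanishes[OF f that])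
  have g: "g \<in> borel_measurable unit_lebesgue" "AE x in unit_lebesgue. g x = S x"
    unfolding g_def S_def by (rule B.walsh_inverse_finite[of q] f_tail, assumption?)+
  \<comment> \<open>The transform does not see the choice of a representative.\<close>
  have gS: "walsh_transform N A g n = L2_inner S (walsh N A n)" for n
    unfolding walsh_transform_def
    using g step_on_measurable[OF S A.walsh_pow_pos] A.walsh_L2[of n]
    by (intro L2_inner_AE_cong) (auto simp: L2_unit_def)
  have g_tail: "walsh_transform N A g n = 0" if "n \<ge> ?D" for n
    unfolding gS by (rule A.walsh_coefficient_vanishes[OF S that])
  have gg: "AE x in unit_lebesgue. walsh_inverse N B (walsh_transform N A g) x
      = (\<Sum>n<?D. walsh_transform N A g n * walsh N B n x)"
    by (rule B.walsh_inverse_finite(2)) (rule g_tail)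
  have "(\<Sum>n<?D. walsh_transform N A g n * walsh N B n x) = f x" if x: "x \<in> {0..<1}" for x
  proof -
    have swap: "walsh_transform N A g n
        = (\<Sum>m<?D. walsh_transform N A f m * L2_inner (walsh N A m) (walsh N B n))" if "n < ?D" for n
    proof -
      have "L2_inner S (walsh N A n)
          = (\<Sum>m<?D. walsh_transform N A f m * L2_inner (walsh N B m) (walsh N A n))"
        unfolding S_def using that
        by (intro L2_inner_sum_left A.inner_integrable[of q] B.walsh_step) auto
      then show ?thesis
        using assms(7) that by (simp add: gS)
    qed
    have "(\<Sum>n<?D. walsh_transform N A g n * walsh N B n x)
        = (\<Sum>n<?D. \<Sum>m<?D. walsh_transform N A f m *
            (L2_inner (walsh N A m) (walsh N B n) * walsh N B n x))"
      by (intro sum.cong) (auto simp: swap sum_distrib_right mult.assoc)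
    also have "\<dots> = (\<Sum>m<?D. walsh_transform N A f m *
            (\<Sum>n<?D. L2_inner (walsh N A m) (walsh N B n) * walsh N B n x))"
      by (subst sum.swap) (simp add: sum_distrib_left)
    also have "\<dots> = (\<Sum>m<?D. walsh_transform N A f m * walsh N A m x)"
      by (intro sum.cong) (auto simp: B.walsh_expansion[OF A.walsh_step x])
    also have "\<dots> = f x"
      unfolding walsh_transform_def by (rule A.walsh_expansion[OF f x])
    finally show ?thesis .
  qed
  then have "AE x in unit_lebesgue. (\<Sum>n<?D. walsh_transform N A g n * walsh N B n x) = f x"
    by (rule AE_unit_lebesgueI)
  with gg have "AE x in unit_lebesgue. walsh_inverse N B (walsh_transform N A g) x = f x"
    by eventually_elim simp
  then show ?thesis
    by (simp add: g_def)
qed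

end
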